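(* Let $G$ be a graph with no isolated vertices. Then $p(G)\leq 2$, where $p(G)$ denotes the $P$-vertex covering number of $G$.
   Context: Graphs are finite, simple and undirected; a graph on $n\ge 1$ vertices has vertex set $[n]=\{1,\ldots,n\}$. For a real symmetric $n\times n$ matrix $A=(a_{ij})$, its support graph $G(A)$ is the graph with vertex set $[n]$ and edge set $\{\{i,j\}: i\neq j,\ a_{ij}\neq 0\}$ (diagonal entries play no role). For a graph $G$ on $n$ vertices, $S(G)=\{A\in\mathbb{R}^{n\times n}: A^{T}=A,\ G(A)=G\}$. For $i\in[n]$, $A(i)$ denotes the principal submatrix of $A$ obtained by deleting the $i$-th row and the $i$-th column. $m_A(\lambda)$ denotes the algebraic multiplicity of $\lambda$ as an eigenvalue of $A$ (equal to $0$ if $\lambda$ is not an eigenvalue). A vertex $i$ of $G$ is called a $P$-vertex of $A\in S(G)$ if $m_{A(i)}(0)-m_A(0)=1$. The $P$-vertex covering number $p(G)$ is the minimum cardinality $|\mathcal{A}|$ of a family $\mathcal{A}\subseteq S(G)$ of non-singular matrices such that every vertex of $G$ is a $P$-vertex of some $A\in\mathcal{A}$; if no such family exists, $p(G)=\infty$. *)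

theory Defs
  imports
    "Jordan_Normal_Form.Char_Poly"
    "HOL-Library.Extended_Nat"
begin

text \<open>
  A graph on \<open>n\<close> vertices has vertex set \<open>{0..<n}\<close> rather than \<open>{1..n}\<close>, to match the
  zero-based indexing of matrices; its edges are two-element sets of vertices.
\<close>

definition simple_graph :: "nat \<Rightarrow> nat set set \<Rightarrow> bool" where
  "simple_graph n E \<longleftrightarrow> n \<ge> 1 \<and> (\<forall>e\<in>E. e \<subseteq> {0..<n} \<and> card e = 2)"

definition isolated_vertex :: "nat \<Rightarrow> nat set set \<Rightarrow> nat \<Rightarrow> bool" where
  "isolated_vertex n E i \<longleftrightarrow> i < n \<and> (\<forall>e\<in>E. i \<notin> e)"

definition support_edges :: "real mat \<Rightarrow> nat set set" where
  "support_edges A = {{i, j} | i j. i < dim_row A \<and> j < dim_row A \<and> i \<noteq> j \<and> A $$ (i, j) \<noteq> 0}"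

definition graph_matrices :: "nat \<Rightarrow> nat set set \<Rightarrow> real mat set" where
  "graph_matrices n E = {A \<in> carrier_mat n n. transpose_mat A = A \<and> support_edges A = E}"

definition alg_mult :: "real mat \<Rightarrow> real \<Rightarrow> nat" where
  "alg_mult A x = order x (char_poly A)"

(* The difference is taken over the integers, since it may be negative. *)
definition P_vertex :: "real mat \<Rightarrow> nat \<Rightarrow> bool" where
  "P_vertex A i \<longleftrightarrow>
     i < dim_row A \<and> int (alg_mult (mat_delete A i i) 0) - int (alg_mult A 0) = 1"

(* Finiteness is required because card is 0 on infinite sets; it loses nothing, as every
   covering family contains a finite one (there are only n vertices). *)
definition P_vertex_cover :: "nat \<Rightarrow> nat set set \<Rightarrow> real mat set \<Rightarrow> bool" where
  "P_vertex_cover n E \<A> \<longleftrightarrow>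
     finite \<A> \<and> \<A> \<subseteq> graph_matrices n E \<and> (\<forall>A\<in>\<A>. invertible_mat A) \<and>
     (\<forall>i<n. \<exists>A\<in>\<A>. P_vertex A i)"

(* In enat the infimum of a nonempty set is attained, and the infimum of the empty set
   is infinity. *)
definition P_vertex_covering_number :: "nat \<Rightarrow> nat set set \<Rightarrow> enat" where
  "P_vertex_covering_number n E = (INF \<A>\<in>{\<A>. P_vertex_cover n E \<A>}. enat (card \<A>))"

end

theory Submission
  imports Defs "HOL-Analysis.Brouwer_Fixpoint" "HOL-Analysis.Function_Metric"
begin

text \<open>
  For a non-singular symmetric \<open>A\<close>, the vertex \<open>i\<close> is a P-vertex as soon as \<open>A(i)\<close> is singular. The
  vertices split into two parts such that each vertex has a neighbour in the other part, so it
  suffices to find, for a vertex set \<open>C\<close> and a choice \<open>f\<close> of a neighbour outside \<open>C\<close> for every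
  element of \<open>C\<close>, one non-singular matrix for which all of \<open>C\<close> consists of P-vertices.

  If the edges are only the \<open>{c, f c}\<close> (a union of stars), put weights \<open>b\<^sub>c\<close> on these edges, \<open>1\<close> at
  the diagonal entries of \<open>C\<close>, and choose the other diagonal entries so that the Schur complement of
  the block of \<open>C\<close> is minus the identity. Then \<open>det A(c) = (1 - b\<^sub>c\<^sup>2) det A\<close>, which changes sign at
  \<open>b\<^sub>c = 1\<close>. Giving the remaining edges a small weight \<open>e \<noteq> 0\<close> keeps these signs on the faces of the
  cube \<open>1/2 \<le> b\<^sub>c \<le> 3/2\<close>, and the Poincare-Miranda theorem yields a common zero of all \<open>det A(c)\<close>.
\<close>

unbundle no vec_syntax

section \<open>Zeros of sign-changing maps on a cube\<close>

text \<open>Tychonoff's theorem. With all of \<open>nat\<close> as index set the points form a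
  metric space, so convergent subsequences exist as well.\<close>

lemma compact_cube: "compact (PiE UNIV (\<lambda>_. {0..1}) :: (nat \<Rightarrow> real) set)"
proof -
  have "compactin (product_topology (\<lambda>_. euclidean) UNIV) (PiE UNIV (\<lambda>_::nat. {0..1::real}))"
    by (simp add: compactin_PiE)
  then show ?thesis
    by (simp add: euclidean_product_topology)
qed

lemma tendsto_coordinatewise:
  fixes X :: "'b \<Rightarrow> 'a \<Rightarrow> 'c::topological_space"
  shows "(X \<longlongrightarrow> l) F \<longleftrightarrow> (\<forall>j. ((\<lambda>m. X m j) \<longlongrightarrow> l j) F)"
proof -
  have "limitin (product_topology (\<lambda>_. euclidean) UNIV) X l F \<longleftrightarrow>
    (\<forall>j. limitin euclidean (\<lambda>m. X m j) (l j) F)"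
    by (subst limitin_componentwise) auto
  then show ?thesis
    by (simp add: euclidean_product_topology)
qed

text \<open>Label the points of ever finer grids by the signs of the \<open>F i\<close>. Kuhn's
  combinatorial lemma finds a cell in which every \<open>F i\<close> takes both signs, and a limit
  point of these cells is a common zero by continuity.\<close>

lemma poincare_miranda:
  fixes F :: "nat \<Rightarrow> (nat \<Rightarrow> real) \<Rightarrow> real"
  assumes cont: "\<And>i. i < n \<Longrightarrow> continuous_on UNIV (F i)"
    and lo: "\<And>i x. i < n \<Longrightarrow> x \<in> PiE UNIV (\<lambda>_. {0..1}) \<Longrightarrow> x i = 0 \<Longrightarrow> F i x < 0"
    and hi: "\<And>i x. i < n \<Longrightarrow> x \<in> PiE UNIV (\<lambda>_. {0..1}) \<Longrightarrow> x i = 1 \<Longrightarrow> F i x > 0"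
  obtains x where "x \<in> PiE UNIV (\<lambda>_. {0..1})" "\<And>i. i < n \<Longrightarrow> F i x = 0"
proof -
  \<comment> \<open>Grid points of mesh \<open>1 / p\<close>, with the coordinates from
    \<open>n\<close> on set to 0; \<open>near q y\<close> says that \<open>y\<close> is a corner of
    the cell with lowest corner \<open>q\<close>.\<close>
  define pt :: "nat \<Rightarrow> (nat \<Rightarrow> nat) \<Rightarrow> nat \<Rightarrow> real" where
    "pt p y = (\<lambda>j. if j < n then real (y j) / real p else 0)" for p y
  define near where "near q y \<longleftrightarrow> (\<forall>j<n. q j \<le> y j \<and> y j \<le> q j + 1)" for q y :: "nat \<Rightarrow> nat"
  have pt_in: "pt p y \<in> PiE UNIV (\<lambda>_. {0..1})" if "\<forall>j<n. y j \<le> p" for p y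
    using that by (cases "p = 0") (auto simp: pt_def divide_simps)
  have "\<exists>q. (\<forall>i<n. q i < Suc m) \<and> (\<forall>i<n. \<exists>r s. near q r \<and> near q s \<and>
    F i (pt (Suc m) r) \<ge> 0 \<and> F i (pt (Suc m) s) < 0)" for m
  proof -
    let ?p = "Suc m"
    define label :: "(nat \<Rightarrow> nat) \<Rightarrow> nat \<Rightarrow> nat"
      where "label y i = (if F i (pt ?p y) \<ge> 0 then 1 else 0)" for y i
    obtain q where q: "\<forall>i<n. q i < ?p"
      and rs: "\<forall>i<n. \<exists>r s. (\<forall>j<n. q j \<le> r j \<and> r j \<le> q j + 1) \<and>
        (\<forall>j<n. q j \<le> s j \<and> s j \<le> q j + 1) \<and> label r i \<noteq> label s i"
    proof (rule kuhn_lemma[of ?p n label])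
      show "\<forall>x. (\<forall>i<n. x i \<le> ?p) \<longrightarrow> (\<forall>i<n. x i = 0 \<longrightarrow> label x i = 0)"
        using lo[OF _ pt_in[of _ ?p]] by (force simp: label_def pt_def not_le)
      show "\<forall>x. (\<forall>i<n. x i \<le> ?p) \<longrightarrow> (\<forall>i<n. x i = ?p \<longrightarrow> label x i = 1)"
      proof (intro allI impI)
        fix x i assume "\<forall>i<n. x i \<le> ?p" "i < n" "x i = ?p"
        then have "F i (pt ?p x) > 0" by (intro hi pt_in) (auto simp: pt_def)
        then show "label x i = 1" by (simp add: label_def)
      qed
    qed (auto simp: label_def)
    have "\<exists>r s. near q r \<and> near q s \<and> F i (pt ?p r) \<ge> 0 \<and> F i (pt ?p s) < 0" if "i < n" for i
    proof -
      from rs that obtain r s where "near q r" "near q s" "label r i \<noteq> label s i"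
        unfolding near_def by blast
      then show ?thesis
        by (cases "F i (pt ?p r) \<ge> 0") (auto simp: label_def not_le split: if_splits)
    qed
    with q show ?thesis by blast
  qed
  then obtain q where q: "\<And>m i. i < n \<Longrightarrow> q m i < Suc m"
    and "\<And>m. \<forall>i<n. \<exists>r s. near (q m) r \<and> near (q m) s \<and>
      F i (pt (Suc m) r) \<ge> 0 \<and> F i (pt (Suc m) s) < 0"
    by metis
  then obtain R S where R: "\<And>m i. i < n \<Longrightarrow> near (q m) (R m i)"
      "\<And>m i. i < n \<Longrightarrow> F i (pt (Suc m) (R m i)) \<ge> 0"
    and S: "\<And>m i. i < n \<Longrightarrow> near (q m) (S m i)"
      "\<And>m i. i < n \<Longrightarrow> F i (pt (Suc m) (S m i)) < 0"
    by metis
  have "seq_compact (PiE UNIV (\<lambda>_. {0..1}) :: (nat \<Rightarrow> real) set)"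
    using compact_cube by (simp add: compact_eq_seq_compact_metric)
  moreover have "pt (Suc m) (q m) \<in> PiE UNIV (\<lambda>_. {0..1})" for m
    using q by (intro pt_in) (auto intro: less_imp_le)
  ultimately obtain l r where l: "l \<in> PiE UNIV (\<lambda>_. {0..1})" and r: "strict_mono r"
    and lim: "((\<lambda>m. pt (Suc m) (q m)) \<circ> r) \<longlonglongrightarrow> l"
    by (elim seq_compactE[where f = "\<lambda>m. pt (Suc m) (q m)"]) auto
  \<comment> \<open>Two corners of one cell differ by at most the mesh in each coordinate, so any
    choice of corners has the same limit.\<close>
  have near_lim: "(\<lambda>m. pt (Suc (r m)) (y (r m))) \<longlonglongrightarrow> l" if "\<And>m. near (q m) (y m)" for y
    unfolding tendsto_coordinatewise
  proof
    fix j
    have "(\<lambda>m. pt (Suc (r m)) (q (r m)) j) \<longlonglongrightarrow> l j"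
      using lim unfolding tendsto_coordinatewise by (simp add: o_def)
    moreover have "(\<lambda>m. pt (Suc (r m)) (y (r m)) j - pt (Suc (r m)) (q (r m)) j) \<longlonglongrightarrow> 0"
    proof (rule Lim_null_comparison)
      show "(\<lambda>m. 1 / real (Suc (r m))) \<longlonglongrightarrow> 0"
        using LIMSEQ_subseq_LIMSEQ[OF lim_1_over_n[THEN LIMSEQ_Suc] r] by (simp add: o_def)
      show "\<forall>\<^sub>F m in sequentially. norm (pt (Suc (r m)) (y (r m)) j - pt (Suc (r m)) (q (r m)) j)
          \<le> 1 / real (Suc (r m))"
      proof (intro always_eventually allI)
        fix m
        have "j < n \<Longrightarrow> \<bar>real (y (r m) j) - real (q (r m) j)\<bar> \<le> 1"
          using that[of "r m"] by (auto simp: near_def)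
        then show "norm (pt (Suc (r m)) (y (r m)) j - pt (Suc (r m)) (q (r m)) j)
          \<le> 1 / real (Suc (r m))"
          by (auto simp: pt_def diff_divide_distrib[symmetric] abs_divide
              simp del: of_nat_Suc intro: divide_right_mono)
      qed
    qed
    ultimately show "(\<lambda>m. pt (Suc (r m)) (y (r m)) j) \<longlonglongrightarrow> l j"
      using tendsto_add by fastforce
  qed
  have "F i l = 0" if i: "i < n" for i
  proof (rule antisym)
    have c: "isCont (F i) l"
      using cont[OF i] by (simp add: continuous_on_eq_continuous_at)
    have "(\<lambda>m. F i (pt (Suc (r m)) (R (r m) i))) \<longlonglongrightarrow> F i l"
      using isCont_tendsto_compose[OF c near_lim[of "\<lambda>m. R m i"]] R(1)[OF i] by simp
    then show "0 \<le> F i l"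
      by (rule LIMSEQ_le_const) (use R(2)[OF i] in auto)
    have "(\<lambda>m. F i (pt (Suc (r m)) (S (r m) i))) \<longlonglongrightarrow> F i l"
      using isCont_tendsto_compose[OF c near_lim[of "\<lambda>m. S m i"]] S(1)[OF i] by simp
    then show "F i l \<le> 0"
      by (rule LIMSEQ_le_const2) (use S(2)[OF i] in \<open>auto intro: less_imp_le\<close>)
  qed
  with l show ?thesis by (rule that)
qed

section \<open>Stability of strict signs under small perturbations\<close>

text \<open>By the tube lemma, the open set where \<open>h\<close> is positive contains a whole
  neighbourhood of \<open>t\<close> times \<open>K\<close>. This carries signs known at
  \<open>e = 0\<close> over to small \<open>e\<close>, uniformly on a face of the cube.\<close>

lemma eventually_pos_on_compact:
  fixes h :: "'a::topological_space \<Rightarrow> 'b::topological_space \<Rightarrow> real"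
  assumes "compact K" "continuous_on UNIV (\<lambda>z. h (fst z) (snd z))" "\<And>x. x \<in> K \<Longrightarrow> h t x > 0"
  shows "\<forall>\<^sub>F s in nhds t. \<forall>x\<in>K. h s x > 0"
proof -
  let ?W = "{z. 0 < h (fst z) (snd z)}"
  have "open ?W"
    by (rule open_Collect_less[OF continuous_on_const assms(2)])
  moreover have "{t} \<times> K \<subseteq> ?W"
    using assms(3) by auto
  ultimately obtain X where "t \<in> X" "open X" "X \<times> K \<subseteq> ?W"
    using tube_lemma[OF assms(1), of ?W t] by blast
  then show ?thesis
    unfolding eventually_nhds by (intro exI[of _ X]) auto
qed

lemma continuous_on_det:
  fixes M :: "'a::topological_space \<Rightarrow> 'b::{comm_ring_1,real_normed_algebra} mat"
  assumes "\<And>z. M z \<in> carrier_mat n n"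
    and "\<And>i j. i < n \<Longrightarrow> j < n \<Longrightarrow> continuous_on S (\<lambda>z. M z $$ (i, j))"
  shows "continuous_on S (\<lambda>z. det (M z))"
  unfolding det_def'[OF assms(1)]
proof (intro continuous_on_sum continuous_on_mult continuous_on_const continuous_on_prod)
  fix p i assume "p \<in> {p. p permutes {0..<n}}" "i \<in> {0..<n}"
  then show "continuous_on S (\<lambda>z. M z $$ (i, p i))"
    by (intro assms(2)) (auto dest: permutes_in_image[of p "{0..<n}" i])
qed

section \<open>Characteristic polynomials and P-vertices\<close>

lemma coeff_0_char_poly_eq_0_iff:
  fixes A :: "'a::field mat"
  assumes "A \<in> carrier_mat n n"
  shows "coeff (char_poly A) 0 = 0 \<longleftrightarrow> det A = 0"
proof -
  have "coeff (char_poly A) 0 = 0 \<longleftrightarrow> eigenvalue A 0"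
    using eigenvalue_root_char_poly[OF assms] by (simp add: poly_0_coeff_0)
  also have "\<dots> \<longleftrightarrow> det A = 0"
  proof -
    have "A *\<^sub>v v = 0 \<cdot>\<^sub>v v \<longleftrightarrow> A *\<^sub>v v = 0\<^sub>v n" if "v \<in> carrier_vec n" for v
    proof -
      have "0 \<cdot>\<^sub>v v = 0\<^sub>v n" using that by (intro eq_vecI) auto
      then show ?thesis by simp
    qed
    then show ?thesis
      unfolding det_0_iff_vec_prod_zero_field[OF assms] eigenvalue_def eigenvector_def
      using assms by auto
  qed
  finally show ?thesis .
qed

lemma order_0_eq_1:
  fixes p :: "'a::idom poly"
  assumes "coeff p 0 = 0" "coeff p 1 \<noteq> 0"
  shows "order 0 p = 1"
proof -
  have "p \<noteq> 0" using assms by auto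
  have "[:- 0, 1:] ^ 1 dvd p"
    using assms(1) monom_1_dvd_iff'[of 1 p] by (simp add: monom_altdef)
  moreover have "\<not> [:- 0, 1:] ^ Suc 1 dvd p"
    using assms(2) monom_1_dvd_iff'[of 2 p] by (auto simp: monom_altdef)
  ultimately show ?thesis
    by (metis order_unique_lemma)
qed

lemma mat_delete_char_poly_matrix:
  assumes "A \<in> carrier_mat n n"
  shows "mat_delete (char_poly_matrix A) i i = char_poly_matrix (mat_delete A i i)"
  using assms by (intro eq_matI) (auto simp: char_poly_matrix_def mat_delete_def)

lemma cofactor_diag: "cofactor A i i = det (mat_delete A i i)"
  by (simp add: cofactor_def)

text \<open>As 0 is no eigenvalue of \<open>A\<close>, it has to be a simple root of the
  characteristic polynomial of \<open>A(i)\<close>. Singularity makes it a root; symmetry of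
  \<open>A\<close> makes it simple, by comparing low coefficients in a column of the adjugate of
  \<open>x - A\<close>.\<close>

lemma P_vertexI:
  fixes A :: "real mat"
  assumes A: "A \<in> carrier_mat n n" and sym: "transpose_mat A = A" and nonsing: "det A \<noteq> 0"
    and i: "i < n" and sing: "det (mat_delete A i i) = 0"
  shows "P_vertex A i"
proof -
  define M where "M = char_poly_matrix A"
  have M: "M \<in> carrier_mat n n" using A by (simp add: M_def)
  define w where "w k = cofactor M i k" for k \<comment> \<open>the \<open>i\<close>-th column of the adjugate of \<open>M\<close>\<close>
  let ?\<phi> = "char_poly A" and ?B = "mat_delete A i i"
  have B: "?B \<in> carrier_mat (n - 1) (n - 1)" using mat_delete_carrier[OF A] .
  have wi: "w i = char_poly ?B"
    by (simp add: w_def cofactor_diag M_def mat_delete_char_poly_matrix[OF A] char_poly_def)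
  have wi0: "coeff (w i) 0 = 0"
    using sing coeff_0_char_poly_eq_0_iff[OF B] by (simp add: wi)
  have phi0: "coeff ?\<phi> 0 \<noteq> 0"
    using nonsing coeff_0_char_poly_eq_0_iff[OF A] by simp
  have symA: "A $$ (j, k) = A $$ (k, j)" if "j < n" "k < n" for j k
    using sym that A by (metis carrier_matD index_transpose_mat(1))
  have eq: "[:0, 1:] * w k - (\<Sum>j<n. Polynomial.smult (A $$ (k, j)) (w j)) = (if k = i then ?\<phi> else 0)"
    if k: "k < n" for k
  proof -
    have "(\<Sum>j<n. M $$ (k, j) * w j) = (M * adj_mat M) $$ (k, i)"
      using M k i by (simp add: adj_mat_def w_def scalar_prod_def lessThan_atLeast0)
    also have "\<dots> = (if k = i then ?\<phi> else 0)"
      using adj_mat(2)[OF M] k i by (simp add: M_def char_poly_def)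
    also have "(\<Sum>j<n. M $$ (k, j) * w j) =
      (\<Sum>j<n. (if j = k then [:0, 1:] * w j else 0) - Polynomial.smult (A $$ (k, j)) (w j))"
      using A k by (intro sum.cong refl) (auto simp: M_def char_poly_matrix_def algebra_simps)
    also have "\<dots> = [:0, 1:] * w k - (\<Sum>j<n. Polynomial.smult (A $$ (k, j)) (w j))"
      using k by (simp add: sum_subtractf)
    finally show ?thesis .
  qed
  have c0: "(\<Sum>j<n. A $$ (k, j) * coeff (w j) 0) = (if k = i then - coeff ?\<phi> 0 else 0)"
    if "k < n" for k
    using arg_cong[OF eq[OF that], of "\<lambda>p. coeff p 0"] by (auto simp: coeff_sum)
  have c1: "coeff (w k) 0 = (\<Sum>j<n. A $$ (k, j) * coeff (w j) 1) + (if k = i then coeff ?\<phi> 1 else 0)"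
    if "k < n" for k
    using arg_cong[OF eq[OF that], of "\<lambda>p. coeff p 1"] by (auto simp: coeff_sum)
  \<comment> \<open>With \<open>w = w\<^sub>0 + w\<^sub>1 x + \<dots>\<close>, the coefficients of \<open>(x - A) w = \<phi> e\<^sub>i\<close> give
    \<open>w\<^sub>0 \<bullet> w\<^sub>0 = w\<^sub>0 \<bullet> A w\<^sub>1 = A w\<^sub>0 \<bullet> w\<^sub>1\<close>, a multiple of the \<open>i\<close>-th entry of \<open>w\<^sub>1\<close>.\<close>
  have "coeff (w i) 1 \<noteq> 0"
  proof
    assume wi1: "coeff (w i) 1 = 0"
    have "(\<Sum>k<n. coeff (w k) 0 * coeff (w k) 0) =
      (\<Sum>k<n. (\<Sum>j<n. coeff (w k) 0 * (A $$ (k, j) * coeff (w j) 1))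
        + (if k = i then coeff (w i) 0 * coeff ?\<phi> 1 else 0))"
      by (intro sum.cong refl) (subst (2) c1, auto simp: algebra_simps sum_distrib_left)
    also have "\<dots> = (\<Sum>k<n. \<Sum>j<n. coeff (w k) 0 * (A $$ (k, j) * coeff (w j) 1))"
      by (simp add: sum.distrib wi0)
    also have "\<dots> = (\<Sum>j<n. \<Sum>k<n. coeff (w j) 1 * (A $$ (j, k) * coeff (w k) 0))"
      by (subst sum.swap) (auto intro!: sum.cong simp: symA)
    also have "\<dots> = (\<Sum>j<n. coeff (w j) 1 * (if j = i then - coeff ?\<phi> 0 else 0))"
      by (intro sum.cong refl) (simp add: sum_distrib_left[symmetric] c0)
    also have "\<dots> = 0"
      using wi1 by (intro sum.neutral) auto
    \<comment> \<open>A vanishing sum of real squares forces \<open>w\<^sub>0 = 0\<close>, whereas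
      \<open>A w\<^sub>0\<close> has the nonzero \<open>i\<close>-th entry
      \<open>- coeff ?\<phi> 0\<close>.\<close>
    finally have "\<forall>k<n. coeff (w k) 0 = 0"
      by (simp add: sum_nonneg_eq_0_iff)
    with c0[OF i] phi0 show False by simp
  qed
  then have "order 0 (char_poly ?B) = 1"
    using wi0 by (intro order_0_eq_1) (simp_all add: wi)
  moreover have "order 0 ?\<phi> = 0"
    using phi0 by (intro order_0I) (simp add: poly_0_coeff_0)
  ultimately show ?thesis
    using A i by (simp add: P_vertex_def alg_mult_def)
qed

section \<open>Adjugates and Cramer's rule\<close>

lemma invertible_mat_if_det_nonzero:
  fixes A :: "'a::field mat"
  assumes A: "A \<in> carrier_mat n n" and "det A \<noteq> 0"
  shows "invertible_mat A"
proof -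
  have "A * (inverse (det A) \<cdot>\<^sub>m adj_mat A) = 1\<^sub>m n" "(inverse (det A) \<cdot>\<^sub>m adj_mat A) * A = 1\<^sub>m n"
    using adj_mat[OF A] assms by (auto simp: mult_smult_distrib[OF A] mult_smult_assoc_mat[OF _ A])
  then show ?thesis
    using A adj_mat(1)[OF A] unfolding invertible_mat_def inverts_mat_def by auto
qed

text \<open>Cramer's rule without division: multiply \<open>A w = e\<^sub>c\<close> by row
  \<open>c\<close> of the adjugate, whose product with \<open>A\<close> is \<open>det A\<close>
  times the \<open>c\<close>-th unit row.\<close>

lemma det_mat_delete_diag:
  fixes A :: "'a::comm_ring_1 mat"
  assumes A: "A \<in> carrier_mat n n" and c: "c < n"
    and w: "\<And>k. k < n \<Longrightarrow> (\<Sum>j<n. A $$ (k, j) * w j) = (if k = c then 1 else 0)"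
  shows "det (mat_delete A c c) = w c * det A"
proof -
  have entry: "(\<Sum>k<n. cofactor A k c * A $$ (k, j)) = (if j = c then det A else 0)" if "j < n" for j
  proof -
    have "(\<Sum>k<n. cofactor A k c * A $$ (k, j)) = (adj_mat A * A) $$ (c, j)"
      using A c that by (simp add: adj_mat_def scalar_prod_def lessThan_atLeast0)
    also have "\<dots> = (if j = c then det A else 0)"
      using adj_mat(3)[OF A] c that by auto
    finally show ?thesis .
  qed
  have "det (mat_delete A c c) = (\<Sum>k<n. cofactor A k c * (if k = c then 1 else 0))"
    using c by (simp add: cofactor_diag if_distrib[of "(*) _"] cong: if_cong)
  also have "\<dots> = (\<Sum>k<n. \<Sum>j<n. cofactor A k c * A $$ (k, j) * w j)"
    by (intro sum.cong refl) (simp add: w[symmetric] sum_distrib_left mult.assoc)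
  also have "\<dots> = (\<Sum>j<n. (\<Sum>k<n. cofactor A k c * A $$ (k, j)) * w j)"
    by (subst sum.swap) (simp add: sum_distrib_right)
  also have "\<dots> = (\<Sum>j<n. if j = c then w c * det A else 0)"
    by (intro sum.cong refl) (simp add: entry)
  also have "\<dots> = w c * det A"
    using c by simp
  finally show ?thesis .
qed


section \<open>Weighted star forests and their perturbation\<close>

text \<open>At \<open>e = 0\<close> only the star edges remain. Eliminating \<open>C\<close> then
  subtracts the sum of the \<open>(b c)\<^sup>2\<close> from the diagonal entry at a centre, which
  leaves -1.\<close>

definition star_mat :: "nat \<Rightarrow> nat set set \<Rightarrow> nat set \<Rightarrow> (nat \<Rightarrow> nat) \<Rightarrow> real \<Rightarrow> (nat \<Rightarrow> real) \<Rightarrow> real mat" where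
  "star_mat n E C f e b = Matrix.mat n n (\<lambda>(i, j).
    if i = j then (if i \<in> C then 1 else (\<Sum>c | c \<in> C \<and> f c = i. (b c)\<^sup>2) - 1)
    else if i \<in> C \<and> j = f i then b i
    else if j \<in> C \<and> i = f j then b j
    else if {i, j} \<in> E then e else 0)"

lemma star_mat_carrier [simp]: "star_mat n E C f e b \<in> carrier_mat n n"
  by (simp add: star_mat_def)

text \<open>The edges \<open>{c, f c}\<close> form stars with leaves in \<open>C\<close> and centres
  outside; several leaves may share a centre.\<close>

locale star_partition =
  fixes n :: nat and E :: "nat set set" and C :: "nat set" and f :: "nat \<Rightarrow> nat"
  assumes graph: "simple_graph n E"
    and C: "C \<subseteq> {0..<n}"
    and f: "\<And>c. c \<in> C \<Longrightarrow> f c < n" "\<And>c. c \<in> C \<Longrightarrow> f c \<notin> C" "\<And>c. c \<in> C \<Longrightarrow> {c, f c} \<in> E"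
begin

lemma star_mat_sym: "transpose_mat (star_mat n E C f e b) = star_mat n E C f e b"
  using f(2) by (intro eq_matI) (auto simp: star_mat_def insert_commute)

lemma star_mat_in_graph_matrices:
  assumes "e \<noteq> 0" "\<And>c. c \<in> C \<Longrightarrow> b c \<noteq> 0"
  shows "star_mat n E C f e b \<in> graph_matrices n E"
proof -
  have off: "star_mat n E C f e b $$ (i, j) \<noteq> 0 \<longleftrightarrow> {i, j} \<in> E" if "i < n" "j < n" "i \<noteq> j" for i j
    using that assms f(3)[of i] f(3)[of j] by (auto simp: star_mat_def insert_commute)
  have "\<exists>i j. x = {i, j} \<and> i < n \<and> j < n \<and> i \<noteq> j" if "x \<in> E" for x
  proof -
    from graph that have "x \<subseteq> {0..<n}" "card x = 2" by (auto simp: simple_graph_def)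
    then show ?thesis unfolding card_2_iff by (metis atLeastLessThan_iff insert_subset)
  qed
  then have "support_edges (star_mat n E C f e b) = E"
    unfolding support_edges_def using off by (fastforce simp: star_mat_def[of n E C f e b])
  then show ?thesis
    by (simp add: graph_matrices_def star_mat_sym)
qed

lemma star_mat_0_row:
  assumes k: "k < n"
  shows "(\<Sum>j<n. star_mat n E C f 0 b $$ (k, j) * v j) =
    (if k \<in> C then v k + b k * v (f k)
     else ((\<Sum>c | c \<in> C \<and> f c = k. (b c)\<^sup>2) - 1) * v k + (\<Sum>c | c \<in> C \<and> f c = k. b c * v c))"
proof (cases "k \<in> C")
  case True
  have "(\<Sum>j<n. star_mat n E C f 0 b $$ (k, j) * v j) =
    (\<Sum>j<n. (if j = k then v k else 0) + (if j = f k then b k * v (f k) else 0))"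
    using True k f(2) by (intro sum.cong refl) (auto simp: star_mat_def)
  then show ?thesis
    using True k f(1) by (simp add: sum.distrib)
next
  case False
  let ?a = "(\<Sum>c | c \<in> C \<and> f c = k. (b c)\<^sup>2) - 1"
  have "(\<Sum>j<n. star_mat n E C f 0 b $$ (k, j) * v j) =
    (\<Sum>j<n. (if j = k then ?a * v k else 0) + (if j \<in> C \<and> f j = k then b j * v j else 0))"
    using False k by (intro sum.cong refl) (auto simp: star_mat_def)
  also have "\<dots> = ?a * v k + (\<Sum>j<n. if j \<in> C \<and> f j = k then b j * v j else 0)"
    using k by (simp add: sum.distrib)
  also have "(\<Sum>j<n. if j \<in> C \<and> f j = k then b j * v j else 0) =
      (\<Sum>c | c \<in> C \<and> f c = k. b c * v c)"
    using C by (intro sum.mono_neutral_cong_right) auto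
  finally show ?thesis using False by simp
qed

text \<open>For a kernel vector, the rows in \<open>C\<close> express each leaf entry by the entry
  at its centre. Substituted into the other rows, the squares cancel and \<open>- v $ l = 0\<close>
  is left, whatever the weights are.\<close>

lemma det_star_mat_0: "det (star_mat n E C f 0 b) \<noteq> 0"
proof
  assume "det (star_mat n E C f 0 b) = 0"
  then obtain v where v: "v \<in> carrier_vec n" "v \<noteq> 0\<^sub>v n"
    and kernel: "star_mat n E C f 0 b *\<^sub>v v = 0\<^sub>v n"
    using det_0_iff_vec_prod_zero_field[OF star_mat_carrier] by metis
  have row: "(\<Sum>j<n. star_mat n E C f 0 b $$ (k, j) * v $ j) = 0" if "k < n" for k
  proof -
    have "(star_mat n E C f 0 b *\<^sub>v v) $ k = (\<Sum>j<n. star_mat n E C f 0 b $$ (k, j) * v $ j)"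
      using that v(1) carrier_matD[OF star_mat_carrier[of n E C f 0 b]]
      by (simp add: scalar_prod_def lessThan_atLeast0)
    with kernel that show ?thesis by simp
  qed
  have vC: "v $ c = - b c * v $ f c" if "c \<in> C" for c
    using row[of c] C that by (auto simp: star_mat_0_row)
  have vL: "v $ l = 0" if "l < n" "l \<notin> C" for l
  proof -
    have "(\<Sum>c | c \<in> C \<and> f c = l. b c * v $ c) = - (\<Sum>c | c \<in> C \<and> f c = l. (b c)\<^sup>2) * v $ l"
      by (auto simp: vC power2_eq_square sum_distrib_right sum_negf[symmetric] intro!: sum.cong)
    then show ?thesis
      using row[OF that(1)] that by (simp add: star_mat_0_row left_diff_distrib)
  qed
  have "v $ k = 0" if "k < n" for k
    using that vC[of k] vL[of k] vL[of "f k"] f by (cases "k \<in> C") auto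
  then have "v = 0\<^sub>v n" using v by (intro eq_vecI) auto
  with v show False by simp
qed

text \<open>Eliminating \<open>C\<close> from \<open>A w = e\<^sub>c\<close> gives
  \<open>w (f c) = b c\<close> and 0 elsewhere outside \<open>C\<close>; back substitution gives
  \<open>w c = 1 - (b c)\<^sup>2\<close>, and Cramer's rule applies.\<close>

lemma det_delete_star_mat_0:
  assumes c: "c \<in> C"
  shows "det (mat_delete (star_mat n E C f 0 b) c c) = (1 - (b c)\<^sup>2) * det (star_mat n E C f 0 b)"
proof -
  \<comment> \<open>\<open>w\<close> solves \<open>A w = e\<^sub>c\<close>, so its \<open>c\<close>-th entry is \<open>det A(c) / det A\<close>.\<close>
  define w where "w j = (if j = c then 1 - (b c)\<^sup>2 else if j = f c then b c
    else if j \<in> C \<and> f j = f c then - b j * b c else 0)" for j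
  have fin: "finite {d \<in> C. f d = f c}" using C by (auto intro: finite_subset)
  have "(\<Sum>j<n. star_mat n E C f 0 b $$ (k, j) * w j) = (if k = c then 1 else 0)" if k: "k < n" for k
  proof (cases "k \<in> C")
    case True
    then show ?thesis using k c f(2)
      by (auto simp: star_mat_0_row w_def power2_eq_square)
  next
    case False
    show ?thesis
    proof (cases "k = f c")
      case True
      have "(\<Sum>d | d \<in> C \<and> f d = f c. b d * w d) =
        (\<Sum>d | d \<in> C \<and> f d = f c. (if d = c then b c else 0) - (b d)\<^sup>2 * b c)"
        using f(2) c by (intro sum.cong refl) (auto simp: w_def power2_eq_square algebra_simps)
      also have "\<dots> = b c - (\<Sum>d | d \<in> C \<and> f d = f c. (b d)\<^sup>2) * b c"
        using fin c by (simp add: sum_subtractf sum_distrib_right)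
      finally show ?thesis
        using True False k c by (auto simp: star_mat_0_row w_def algebra_simps)
    next
      case False
      have "(\<Sum>d | d \<in> C \<and> f d = k. b d * w d) = 0"
        using False f(2) c by (intro sum.neutral) (auto simp: w_def)
      then show ?thesis
        using False \<open>k \<notin> C\<close> k c by (auto simp: star_mat_0_row w_def)
    qed
  qed
  from det_mat_delete_diag[OF star_mat_carrier _ this] show ?thesis
    using c C by (auto simp: w_def)
qed

lemma continuous_on_star_mat:
  fixes b :: "'a::topological_space \<Rightarrow> nat \<Rightarrow> real"
  assumes "continuous_on S e" "\<And>j. continuous_on S (\<lambda>z. b z j)" "i < n" "j < n"
  shows "continuous_on S (\<lambda>z. star_mat n E C f (e z) (b z) $$ (i, j))"
proof -
  \<comment> \<open>The case distinctions in \<open>star_mat\<close> depend on the indices only,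
    never on the parameter \<open>z\<close>.\<close>
  have const_if: "continuous_on S (\<lambda>z. if P then g z else h z)"
    if "continuous_on S g" "continuous_on S h" for P and g h :: "'a \<Rightarrow> real"
    using that by (cases P) simp_all
  show ?thesis
    using assms(3,4) by (simp add: star_mat_def) (intro const_if continuous_intros assms(1,2))
qed

lemma exists_P_vertices:
  "\<exists>A \<in> graph_matrices n E. invertible_mat A \<and> (\<forall>c\<in>C. P_vertex A c)"
proof -
  define K where "K = (PiE UNIV (\<lambda>_. {0..1}) :: (nat \<Rightarrow> real) set)"
  have compact_face: "compact {x \<in> K. x i = t}" for i t
  proof -
    have "closed {x :: nat \<Rightarrow> real. x i = t}"
      by (intro closed_Collect_eq continuous_intros continuous_on_product_coordinates)
    then have "compact (K \<inter> {x. x i = t})"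
      unfolding K_def by (intro compact_Int_closed compact_cube)
    moreover have "K \<inter> {x. x i = t} = {x \<in> K. x i = t}" by blast
    ultimately show ?thesis by simp
  qed
  \<comment> \<open>The shift by 1/2 maps the unit cube to weights between 1/2 and 3/2: never zero,
    and on both sides of the critical value 1.\<close>
  define M where "M e x = star_mat n E C f e (\<lambda>c. 1 / 2 + x c)" for e :: real and x :: "nat \<Rightarrow> real"
  \<comment> \<open>The factor \<open>det (M e x)\<close> makes the sign at \<open>e = 0\<close>
    independent of the sign of that determinant. Coordinates outside \<open>C\<close> get a filler
    that changes sign across the cube.\<close>
  define g where "g i e x = (if i \<in> C then - det (mat_delete (M e x) i i) * det (M e x) else x i - 1 / 2)"
    for i e x
  have M: "M e x \<in> carrier_mat n n" for e x
    by (simp add: M_def)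
  have contM: "continuous_on UNIV (\<lambda>z. M (fst z) (snd z) $$ (i, j))" if "i < n" "j < n" for i j
    unfolding M_def using that
    by (intro continuous_on_star_mat continuous_intros
        continuous_on_compose2[OF continuous_on_product_coordinates]) auto
  have cont_det: "continuous_on UNIV (\<lambda>z. det (M (fst z) (snd z)))"
    by (rule continuous_on_det[OF M contM])
  have cont_del: "continuous_on UNIV (\<lambda>z. det (mat_delete (M (fst z) (snd z)) i i))" for i
  proof (rule continuous_on_det)
    show "mat_delete (M (fst z) (snd z)) i i \<in> carrier_mat (n - 1) (n - 1)" for z
      by (rule mat_delete_carrier[OF M])
    fix r s assume "r < n - 1" "s < n - 1"
    then show "continuous_on UNIV (\<lambda>z. mat_delete (M (fst z) (snd z)) i i $$ (r, s))"
      using contM carrier_matD[OF M] by (auto simp: mat_delete_def)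
  qed
  have cont_g: "continuous_on UNIV (\<lambda>z. g i (fst z) (snd z))" for i
  proof (cases "i \<in> C")
    case True
    then have "g i = (\<lambda>e x. - det (mat_delete (M e x) i i) * det (M e x))"
      by (simp add: g_def fun_eq_iff)
    then show ?thesis
      using continuous_on_mult[OF continuous_on_minus[OF cont_del[of i]] cont_det] by simp
  next
    case False
    then have "g i = (\<lambda>e x. x i - 1 / 2)"
      by (simp add: g_def fun_eq_iff)
    moreover have "continuous_on UNIV (\<lambda>z :: real \<times> (nat \<Rightarrow> real). snd z i)"
      by (rule continuous_on_compose2[OF continuous_on_product_coordinates continuous_on_snd[OF continuous_on_id]]) simp
    ultimately show ?thesis
      by (simp add: continuous_on_diff)
  qed
  have g0: "g i 0 x = ((1 / 2 + x i)\<^sup>2 - 1) * (det (M 0 x))\<^sup>2" if "i \<in> C" for i x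
    using that by (simp add: g_def M_def det_delete_star_mat_0 power2_eq_square algebra_simps)
  have D0: "(det (M 0 x))\<^sup>2 > 0" for x
    using det_star_mat_0 by (simp add: M_def)
  have lo0: "- g i 0 x > 0" if "x i = 0" for i x
    using that D0[of x] by (cases "i \<in> C") (auto simp: g0 power2_eq_square, simp add: g_def)
  have hi0: "g i 0 x > 0" if "x i = 1" for i x
    using that D0[of x] by (cases "i \<in> C") (auto simp: g0 power2_eq_square, simp add: g_def)
  \<comment> \<open>Squaring expresses non-singularity as a strict inequality, which persists for
    small \<open>e\<close>.\<close>
  have "\<forall>\<^sub>F e in nhds 0. \<forall>x\<in>K. (det (M e x))\<^sup>2 > 0"
    using compact_cube D0 unfolding K_def
    by (intro eventually_pos_on_compact continuous_on_power cont_det) auto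
  moreover have "\<forall>\<^sub>F e in nhds 0. \<forall>i\<in>{0..<n}. \<forall>x\<in>{x \<in> K. x i = 0}. - g i e x > 0"
    by (intro eventually_ball_finite ballI eventually_pos_on_compact compact_face
        continuous_on_minus cont_g lo0) auto
  moreover have "\<forall>\<^sub>F e in nhds 0. \<forall>i\<in>{0..<n}. \<forall>x\<in>{x \<in> K. x i = 1}. g i e x > 0"
    by (intro eventually_ball_finite ballI eventually_pos_on_compact compact_face cont_g hi0) auto
  ultimately have "\<forall>\<^sub>F e in nhds 0. (\<forall>x\<in>K. (det (M e x))\<^sup>2 > 0) \<and>
     (\<forall>i\<in>{0..<n}. \<forall>x\<in>{x \<in> K. x i = 0}. - g i e x > 0) \<and>
     (\<forall>i\<in>{0..<n}. \<forall>x\<in>{x \<in> K. x i = 1}. g i e x > 0)"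
    by eventually_elim blast
  \<comment> \<open>The punctured filter supplies an \<open>e \<noteq> 0\<close>, so that every
    remaining edge really occurs in the support.\<close>
  then have "\<forall>\<^sub>F e in at (0::real). e \<noteq> 0 \<and> (\<forall>x\<in>K. (det (M e x))\<^sup>2 > 0) \<and>
     (\<forall>i\<in>{0..<n}. \<forall>x\<in>{x \<in> K. x i = 0}. - g i e x > 0) \<and>
     (\<forall>i\<in>{0..<n}. \<forall>x\<in>{x \<in> K. x i = 1}. g i e x > 0)"
    unfolding eventually_at_filter by eventually_elim blast
  then obtain e where e: "e \<noteq> 0" and D: "\<And>x. x \<in> K \<Longrightarrow> (det (M e x))\<^sup>2 > 0"
    and lo: "\<And>i x. i < n \<Longrightarrow> x \<in> K \<Longrightarrow> x i = 0 \<Longrightarrow> g i e x < 0"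
    and hi: "\<And>i x. i < n \<Longrightarrow> x \<in> K \<Longrightarrow> x i = 1 \<Longrightarrow> g i e x > 0"
    by (auto dest!: eventually_happens simp: neg_less_0_iff_less simp del: zero_less_power2)
  have "continuous_on UNIV (g i e)" for i
  proof -
    have "continuous_on UNIV (\<lambda>x. g i (fst (e, x)) (snd (e, x)))"
      by (rule continuous_on_compose2[OF cont_g])
        (auto intro: continuous_on_Pair continuous_on_const continuous_on_id)
    then show ?thesis by simp
  qed
  then obtain x where x: "x \<in> K" and gx: "\<And>i. i < n \<Longrightarrow> g i e x = 0"
    using poincare_miranda[of n "\<lambda>i. g i e"] lo hi unfolding K_def by blast
  have nonsing: "det (M e x) \<noteq> 0" using D[OF x] by simp
  have "x c \<ge> 0" for c using x by (auto simp: K_def)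
  then have "1 / 2 + x c \<noteq> 0" for c by (smt (verit) divide_pos_pos)
  then have "M e x \<in> graph_matrices n E"
    unfolding M_def using e by (intro star_mat_in_graph_matrices)
  moreover have "P_vertex (M e x) c" if "c \<in> C" for c
  proof (rule P_vertexI[OF M _ nonsing])
    show c: "c < n" using that C by auto
    show "det (mat_delete (M e x) c c) = 0"
      using gx[OF c] that nonsing by (simp add: g_def)
    show "transpose_mat (M e x) = M e x"
      by (simp add: M_def star_mat_sym)
  qed
  ultimately show ?thesis
    using invertible_mat_if_det_nonzero[OF M nonsing] by blast
qed

end

section \<open>Domination and the two-matrix cover\<close>

text \<open>Ore's argument: a dominating set of minimum size is dominated by its complement.\<close>

lemma exists_dominating_partition:
  fixes N :: "'a \<Rightarrow> 'a set"
  assumes "finite V"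
    and sym: "\<And>u v. u \<in> N v \<Longrightarrow> v \<in> N u"
    and N: "\<And>v. v \<in> V \<Longrightarrow> N v \<subseteq> V - {v}" "\<And>v. v \<in> V \<Longrightarrow> N v \<noteq> {}"
  obtains D where "D \<subseteq> V" "\<And>v. v \<in> V - D \<Longrightarrow> N v \<inter> D \<noteq> {}" "\<And>v. v \<in> D \<Longrightarrow> N v - D \<noteq> {}"
proof -
  define dom where "dom D \<longleftrightarrow> D \<subseteq> V \<and> (\<forall>v\<in>V - D. N v \<inter> D \<noteq> {})" for D
  have "dom V" by (simp add: dom_def)
  then obtain D where D: "dom D" and minimal: "\<And>D'. dom D' \<Longrightarrow> card D \<le> card D'"
    using exists_least_iff[of "\<lambda>k. \<exists>D. dom D \<and> card D = k"] by (metis not_le)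
  have "N d - D \<noteq> {}" if d: "d \<in> D" for d
  proof
    assume inD: "N d - D = {}"
    \<comment> \<open>If all neighbours of \<open>d\<close> lie in \<open>D\<close>, then
      \<open>d\<close> is dominated by one of them, and by symmetry no vertex outside
      \<open>D\<close> relies on \<open>d\<close>.\<close>
    have "N v \<inter> (D - {d}) \<noteq> {}" if v: "v \<in> V - (D - {d})" for v
    proof (cases "v = d")
      case True
      then show ?thesis using inD N[of d] v by blast
    next
      case False
      then have "v \<in> V - D" "d \<notin> N v" using v inD sym[of d v] by auto
      then show ?thesis using D by (auto simp: dom_def)
    qed
    then have "dom (D - {d})" using D by (auto simp: dom_def)
    moreover have "card (D - {d}) < card D"
      using d D assms(1) by (intro card_Diff1_less) (auto simp: dom_def intro: finite_subset)
    ultimately show False using minimal by fastforce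
  qed
  with D show ?thesis by (intro that[of D]) (auto simp: dom_def)
qed

theorem theorem1:
  fixes n :: nat and E :: "nat set set"
  assumes "simple_graph n E"
    and "\<And>i. i < n \<Longrightarrow> \<not> isolated_vertex n E i"
  shows "P_vertex_covering_number n E \<le> 2"
proof -
  define N where "N i = {j. j < n \<and> j \<noteq> i \<and> {i, j} \<in> E}" for i
  have edge: "e \<subseteq> {0..<n}" "card e = 2" if "e \<in> E" for e
    using assms(1) that by (auto simp: simple_graph_def)
  have sym: "i \<in> N j" if "j \<in> N i" for i j
    using that edge(1)[of "{i, j}"] by (auto simp: N_def insert_commute)
  have nonempty: "N i \<noteq> {}" if i: "i < n" for i
  proof -
    obtain e where e: "e \<in> E" "i \<in> e"
      using assms(2)[OF i] i unfolding isolated_vertex_def by blast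
    from edge(2)[OF e(1)] obtain a b where "e = {a, b}" "a \<noteq> b"
      unfolding card_2_iff by blast
    with e obtain j where "e = {i, j}" "j \<noteq> i" by blast
    then have "j \<in> N i" using e(1) edge(1)[OF e(1)] by (auto simp: N_def)
    then show ?thesis by blast
  qed
  obtain D where D: "D \<subseteq> {0..<n}" "\<And>v. v \<in> {0..<n} - D \<Longrightarrow> N v \<inter> D \<noteq> {}"
    "\<And>v. v \<in> D \<Longrightarrow> N v - D \<noteq> {}"
  proof (rule exists_dominating_partition[of "{0..<n}" N])
    show "u \<in> N v \<Longrightarrow> v \<in> N u" for u v by (rule sym)
    show "v \<in> {0..<n} \<Longrightarrow> N v \<subseteq> {0..<n} - {v}" for v by (auto simp: N_def)
    show "v \<in> {0..<n} \<Longrightarrow> N v \<noteq> {}" for v using nonempty by simp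
  qed (rule finite_atLeastLessThan, rule that)
  have half: "\<exists>A \<in> graph_matrices n E. invertible_mat A \<and> (\<forall>c\<in>C. P_vertex A c)"
    if "C \<subseteq> {0..<n}" "\<And>c. c \<in> C \<Longrightarrow> N c - C \<noteq> {}" for C
  proof -
    have "\<forall>c\<in>C. \<exists>l. l \<in> N c - C" using that(2) by blast
    then obtain f where "\<forall>c\<in>C. f c \<in> N c - C" by metis
    then interpret star_partition n E C f
      using assms(1) that(1) by unfold_locales (auto simp: N_def)
    show ?thesis by (rule exists_P_vertices)
  qed
  obtain A where A: "A \<in> graph_matrices n E" "invertible_mat A" "\<forall>c\<in>D. P_vertex A c"
    using half[OF D(1)] D(3) by blast
  \<comment> \<open>Domination by \<open>D\<close> is exactly the condition of \<open>half\<close>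
    for the complement of \<open>D\<close>.\<close>
  have "N c - ({0..<n} - D) \<noteq> {}" if "c \<in> {0..<n} - D" for c
    using D(1) D(2)[OF that] by blast
  then obtain B where B: "B \<in> graph_matrices n E" "invertible_mat B"
    "\<forall>c\<in>{0..<n} - D. P_vertex B c"
    using half[of "{0..<n} - D"] by blast
  have "P_vertex_cover n E {A, B}"
    unfolding P_vertex_cover_def using A B by fastforce
  then have "P_vertex_covering_number n E \<le> enat (card {A, B})"
    unfolding P_vertex_covering_number_def by (intro INF_lower) simp
  also have "\<dots> \<le> 2"
    by (cases "A = B") (auto simp: numeral_eq_enat one_enat_def)
  finally show ?thesis .
qed

end
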